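(* Suppose $G_1, G_2, G_3, \dots$ is a family of (non-complete) $k$-regular $\varepsilon$-expander graphs, where $k \geq 3$ and $\varepsilon>0$. Let $H \neq K_n$ be a fixed connected $r$-regular graph on $n$ vertices. For each $i \geq 1$, let $G_i(H)$ be any $(n+1)k$-regular graph obtained by adding $n((n+1)k - r - 2)m_i/2$ edges to $G_i \diamond H$, where $m_i = |E(G_i)|$. Then $G_1(H), G_2(H), G_3(H), \dots$ is a family of $(g_{n,k}(\varepsilon)/2)$-expander graphs of degree $(n+1)k$, where $$g_{n,k}(x) = x + nk + 2 - \sqrt{(x + nk + 2)^2 - 4(n+2)x}.$$
   Context: All graphs are finite, undirected and simple. For a graph $G$, $L(G)$ is its Laplacian matrix (degree matrix minus adjacency matrix) with eigenvalues $0=\mu_1(G)\le\mu_2(G)\le\cdots$, and $a(G)=\mu_2(G)$ is its algebraic connectivity. For a fixed $\varepsilon>0$, an infinite family of graphs $G_1,G_2,\dots$ is a family of $\varepsilon$-expander graphs if (i) all are $k$-regular for a fixed integer $k\ge3$, (ii) $a(G_i)\ge\varepsilon$ for all $i$, and (iii) $|V(G_i)|\to\infty$. $K_n$ is the complete graph on $n$ vertices. The edge corona $G_1\diamond G_2$ of vertex-disjoint graphs $G_1$ (with $m_1$ edges $e_1,\dots,e_{m_1}$) and $G_2$ is the graph obtained by taking one copy of $G_1$ and $m_1$ copies of $G_2$, and joining both end-vertices of the $i$th edge $e_i$ of $G_1$ to every vertex of the $i$th copy of $G_2$, for each $i$. In forming $G_i(H)$, added edges must keep the graph simple. *)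

theory Defs
  imports Complex_Main "HOL-Library.Multiset" "HOL-Computational_Algebra.Polynomial"
    "Jordan_Normal_Form.Char_Poly"
begin

record 'a ugraph =
  verts :: "'a set"
  edges :: "'a set set"

definition simple_graph :: "'a ugraph \<Rightarrow> bool" where
  "simple_graph G \<longleftrightarrow> finite (verts G) \<and> (\<forall>e\<in>edges G. e \<subseteq> verts G \<and> card e = 2)"

definition vertex_degree :: "'a ugraph \<Rightarrow> 'a \<Rightarrow> nat" where
  "vertex_degree G v = card {e \<in> edges G. v \<in> e}"

definition regular_graph :: "nat \<Rightarrow> 'a ugraph \<Rightarrow> bool" where
  "regular_graph k G \<longleftrightarrow> (\<forall>v\<in>verts G. vertex_degree G v = k)"

definition complete_graph :: "'a ugraph \<Rightarrow> bool" where
  "complete_graph G \<longleftrightarrow> edges G = {e. e \<subseteq> verts G \<and> card e = 2}"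

definition connected_graph :: "'a ugraph \<Rightarrow> bool" where
  "connected_graph G \<longleftrightarrow> verts G \<noteq> {} \<and>
     (\<forall>u\<in>verts G. \<forall>v\<in>verts G. (u, v) \<in> {(x, y). {x, y} \<in> edges G}\<^sup>*)"

text \<open>The matrices are indexed through an arbitrary enumeration of the vertex set. Another choice
  conjugates them by a permutation matrix, so the characteristic polynomial does not depend on it.\<close>

definition vertex_list :: "'a ugraph \<Rightarrow> 'a list" where
  "vertex_list G = (SOME vs. distinct vs \<and> set vs = verts G)"

definition degree_matrix :: "'a ugraph \<Rightarrow> real mat" where
  "degree_matrix G = mat (card (verts G)) (card (verts G))
     (\<lambda>(i, j). if i = j then real (vertex_degree G (vertex_list G ! i)) else 0)"

definition adjacency_matrix :: "'a ugraph \<Rightarrow> real mat" where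
  "adjacency_matrix G = mat (card (verts G)) (card (verts G))
     (\<lambda>(i, j). if {vertex_list G ! i, vertex_list G ! j} \<in> edges G then 1 else 0)"

definition laplacian :: "'a ugraph \<Rightarrow> real mat" where
  "laplacian G = degree_matrix G - adjacency_matrix G"

text \<open>The eigenvalues with algebraic multiplicity, in increasing order. The Laplacian of a simple
  graph is real symmetric, so its real eigenvalues are all its eigenvalues.\<close>

definition laplacian_eigenvalues :: "'a ugraph \<Rightarrow> real list" where
  "laplacian_eigenvalues G = sorted_list_of_multiset (proots (char_poly (laplacian G)))"

text \<open>List positions count from 0, so position 1 holds the second smallest eigenvalue. The value is
  unspecified for graphs with fewer than two vertices.\<close>

definition algebraic_connectivity :: "'a ugraph \<Rightarrow> real" where
  "algebraic_connectivity G = laplacian_eigenvalues G ! 1"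

definition expander_family :: "real \<Rightarrow> (nat \<Rightarrow> 'a ugraph) \<Rightarrow> bool" where
  "expander_family \<epsilon> G \<longleftrightarrow>
     \<epsilon> > 0 \<and>
     (\<forall>i. simple_graph (G i)) \<and>
     (\<exists>k\<ge>3. \<forall>i. regular_graph k (G i)) \<and>
     (\<forall>i. algebraic_connectivity (G i) \<ge> \<epsilon>) \<and>
     filterlim (\<lambda>i. card (verts (G i))) at_top sequentially"

text \<open>The copy of \<open>H\<close> belonging to the edge \<open>e\<close> of \<open>G\<close> has the vertices \<open>Inr (e, u)\<close>
  for \<open>u\<close> in \<open>H\<close>.\<close>

definition edge_corona :: "'a ugraph \<Rightarrow> 'b ugraph \<Rightarrow> ('a + 'a set \<times> 'b) ugraph" where
  "edge_corona G H = \<lparr>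
     verts = Inl ` verts G \<union> Inr ` (edges G \<times> verts H),
     edges = {Inl ` e | e. e \<in> edges G}
       \<union> {(\<lambda>u. Inr (e, u)) ` f | e f. e \<in> edges G \<and> f \<in> edges H}
       \<union> {{Inl v, Inr (e, u)} | v e u. e \<in> edges G \<and> v \<in> e \<and> u \<in> verts H}\<rparr>"

text \<open>The number \<open>q\<close> of added edges is real so that it can be given by a formula with subtraction
  and division.\<close>

definition obtained_by_adding_edges :: "real \<Rightarrow> 'a ugraph \<Rightarrow> 'a ugraph \<Rightarrow> bool" where
  "obtained_by_adding_edges q G G' \<longleftrightarrow>
     simple_graph G' \<and> verts G' = verts G \<and> edges G \<subseteq> edges G' \<and>
     real (card (edges G' - edges G)) = q"

definition g_fun :: "nat \<Rightarrow> nat \<Rightarrow> real \<Rightarrow> real" where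
  "g_fun n k x = x + real n * real k + 2
     - sqrt ((x + real n * real k + 2)\<^sup>2 - 4 * (real n + 2) * x)"

end

theory Submission
  imports Defs "Jordan_Normal_Form.Schur_Decomposition"
begin

text \<open>By Courant and Fischer it suffices to bound the Dirichlet energy of \<open>G\<^sub>i(H)\<close> from below on
  functions in one hyperplane, and added edges only increase the energy. Take the hyperplane of
  functions with sum zero over the vertices of \<open>G\<^sub>i\<close> alone, and let \<open>x\<close> be the restriction to
  \<open>G\<^sub>i\<close>. The values on the copies of \<open>H\<close> are unconstrained and can be minimised one at a time: each
  only interacts with the two ends of one edge \<open>{a, b}\<close>, and minimising over it costs
  \<open>(x\<^sub>a + x\<^sub>b)\<^sup>2 / (2 - t)\<close>. The edge sums of these squares are \<open>2 k \<parallel>x\<parallel>\<^sup>2\<close> minus the energy of \<open>x\<close>,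
  which is at least \<open>\<epsilon> \<parallel>x\<parallel>\<^sup>2\<close>, so what remains is nonnegative as soon as
  \<open>t\<^sup>2 - (\<epsilon> + n k + 2) t + (n + 2) \<epsilon> \<ge> 0\<close>. The smaller root is half of \<open>g\<close> at \<open>\<epsilon>\<close>. It is below 2
  because \<open>\<epsilon> \<le> k\<close>, and this is where non-completeness of the \<open>G\<^sub>i\<close> enters.\<close>

section \<open>Spectral theorem for real symmetric matrices\<close>

text \<open>The Hermitian form \<open>S\<close> at the eigenvector \<open>z\<close> is its own
  conjugate, because conjugation amounts to swapping the two summations. It also equals
  \<open>c\<close> times the positive squared norm \<open>N\<close>, so \<open>c\<close> is fixed by
  conjugation.\<close>

lemma symmetric_complex_eigenvalue_real:
  fixes A :: "real mat"
  assumes A: "A \<in> carrier_mat n n" and sym: "transpose_mat A = A"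
    and ev: "eigenvalue (map_mat complex_of_real A) c"
  shows "c \<in> \<real>"
proof -
  let ?A = "map_mat complex_of_real A"
  from ev obtain z where z: "z \<in> carrier_vec n" "z \<noteq> 0\<^sub>v n" and Az: "?A *\<^sub>v z = c \<cdot>\<^sub>v z"
    using A unfolding eigenvalue_def eigenvector_def by auto
  have Aij: "A $$ (i, j) = A $$ (j, i)" if "i < n" "j < n" for i j
    using that A arg_cong[OF sym, of "\<lambda>B. B $$ (j, i)"] by auto
  define S where "S = (\<Sum>i<n. \<Sum>j<n. of_real (A $$ (i, j)) * z $ j * cnj (z $ i))"
  define N where "N = (\<Sum>i<n. (cmod (z $ i))\<^sup>2)"
  have row: "(\<Sum>j<n. of_real (A $$ (i, j)) * z $ j) = c * z $ i" if "i < n" for i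
    using arg_cong[OF Az, of "\<lambda>v. v $ i"] that A z
    by (simp add: scalar_prod_def lessThan_atLeast0)
  have "S = (\<Sum>i<n. c * z $ i * cnj (z $ i))"
    unfolding S_def by (intro sum.cong refl) (simp add: row flip: sum_distrib_right)
  also have "\<dots> = c * of_real N"
    unfolding N_def of_real_sum complex_norm_square by (simp add: sum_distrib_left mult.assoc)
  finally have S: "S = c * of_real N" .
  have "cnj S = (\<Sum>i<n. \<Sum>j<n. of_real (A $$ (i, j)) * cnj (z $ j) * z $ i)"
    unfolding S_def by simp
  also have "\<dots> = (\<Sum>j<n. \<Sum>i<n. of_real (A $$ (i, j)) * cnj (z $ j) * z $ i)"
    by (rule sum.swap)
  also have "\<dots> = S"
    unfolding S_def by (intro sum.cong refl) (simp add: Aij mult_ac)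
  finally have "cnj c * of_real N = c * of_real N"
    using S by simp
  moreover have "N > 0"
  proof -
    from z obtain i where i: "i < n" "z $ i \<noteq> 0"
      by (metis carrier_vecD dim_vec eq_vecI index_zero_vec)
    then show ?thesis
      unfolding N_def by (intro sum_pos2[of _ i]) auto
  qed
  ultimately show ?thesis
    by (simp add: Reals_cnj_iff)
qed

text \<open>The characteristic polynomial splits over the complex numbers and positive dimension
  provides a root; being real, it is a root of the real polynomial too.\<close>

lemma symmetric_real_eigenvalue_exists:
  fixes A :: "real mat"
  assumes A: "A \<in> carrier_mat n n" and sym: "transpose_mat A = A" and n: "n > 0"
  shows "\<exists>e. eigenvalue A e"
proof -
  let ?A = "map_mat complex_of_real A"
  have A': "?A \<in> carrier_mat n n" using A by simp
  obtain as where as: "char_poly ?A = (\<Prod>a\<leftarrow>as. [:- a, 1:])" "length as = n"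
    using char_poly_factorized[OF A'] by blast
  then obtain c where "c \<in> set as" using n by (cases as) auto
  then have root: "poly (char_poly ?A) c = 0"
    unfolding as by (auto simp: poly_prod_list prod_list_zero_iff)
  then have "eigenvalue ?A c" using eigenvalue_root_char_poly[OF A'] by simp
  then obtain e where e: "c = of_real e"
    using symmetric_complex_eigenvalue_real[OF A sym] by (auto elim: Reals_cases)
  have "poly (char_poly A) e = 0"
    using root unfolding e of_real_hom.char_poly_hom[OF A] by simp
  then show ?thesis using eigenvalue_root_char_poly[OF A] by blast
qed

text \<open>Gram-Schmidt applied to a basis starting with \<open>v\<close> leaves \<open>v\<close>
  in front. The columns arise by normalising, which is where the scalar \<open>c\<close> comes
  from.\<close>

lemma orthogonal_matrix_with_first_column:
  fixes v :: "real vec"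
  assumes v: "v \<in> carrier_vec n" and v0: "v \<noteq> 0\<^sub>v n"
  shows "\<exists>W c. W \<in> carrier_mat n n \<and> transpose_mat W * W = 1\<^sub>m n \<and> col W 0 = c \<cdot>\<^sub>v v"
proof -
  have n: "n > 0" using v v0 by (cases n) auto
  interpret cof_vec_space n "TYPE(real)" .
  define b where "b = basis_completion v"
  define ws where "ws = gram_schmidt n b"
  from basis_completion[OF v v0, folded b_def]
  have dist_b: "distinct b" and indep: "\<not> lin_dep (set b)" and b: "set b \<subseteq> carrier_vec n"
    and hdb: "hd b = v" and len_b: "length b = n" by auto
  from hdb len_b n obtain vs where bv: "b = v # vs" by (cases b, auto)
  from gram_schmidt_result[OF b dist_b indep refl, folded ws_def]
  have ws: "set ws \<subseteq> carrier_vec n" "corthogonal ws" "length ws = n"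
    by (auto simp: len_b)
  have hdws: "hd ws = v" using gram_schmidt_hd[OF v, of vs, folded bv] unfolding ws_def .
  \<comment> \<open>Conjugation is trivial over the reals, so \<open>corthogonal\<close> is ordinary
    orthogonality together with nonvanishing squares. The latter justifies normalising by
    \<open>s\<close>.\<close>
  have conj: "conjugate w = w" for w :: "real vec" by (rule eq_vecI) auto
  have orth: "ws ! i \<bullet> ws ! j = 0 \<longleftrightarrow> i \<noteq> j" if "i < n" "j < n" for i j
    using corthogonalD[OF ws(2), of i j] that ws(3) by (simp add: conj)
  have wc: "ws ! i \<in> carrier_vec n" if "i < n" for i
    using ws that by (metis nth_mem subsetD)
  define s where "s i = 1 / sqrt (ws ! i \<bullet> ws ! i)" for i
  define W where "W = mat_of_cols n (map (\<lambda>i. s i \<cdot>\<^sub>v ws ! i) [0..<n])"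
  have W: "W \<in> carrier_mat n n" unfolding W_def by (auto simp: mat_of_cols_def)
  have colW: "col W i = s i \<cdot>\<^sub>v ws ! i" if "i < n" for i
    unfolding W_def using that wc[OF that] by (subst col_mat_of_cols) auto
  have pos: "ws ! i \<bullet> ws ! i > 0" if "i < n" for i
    using orth[OF that that] conjugate_square_ge_0_vec[of "ws ! i"] by (simp add: conj)
  have "transpose_mat W * W = 1\<^sub>m n"
  proof (rule eq_matI)
    fix i j assume "i < dim_row (1\<^sub>m n :: real mat)" "j < dim_col (1\<^sub>m n :: real mat)"
    then have ij: "i < n" "j < n" by auto
    have "(transpose_mat W * W) $$ (i, j) = col W i \<bullet> col W j"
      using W ij by auto
    also have "\<dots> = s i * s j * (ws ! i \<bullet> ws ! j)"
      unfolding colW[OF ij(1)] colW[OF ij(2)] using wc[OF ij(1)] wc[OF ij(2)] by simp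
    also have "\<dots> = (if i = j then 1 else 0)"
      using orth[OF ij] pos[OF ij(1)] by (auto simp: s_def)
    finally show "(transpose_mat W * W) $$ (i, j) = 1\<^sub>m n $$ (i, j)" using ij by simp
  qed (use W in auto)
  moreover have "col W 0 = s 0 \<cdot>\<^sub>v v"
    using colW[OF n] hdws ws(3) n by (cases ws) auto
  ultimately show ?thesis using W by blast
qed

text \<open>Deflation: an orthonormal basis starting with an eigenvector turns the first column of
  \<open>B\<close> into a multiple of the first unit vector. Symmetry does the same to the first
  row, so \<open>B\<close> is block diagonal and induction applies to the block
  \<open>B3\<close>.\<close>

lemma symmetric_orthogonally_diagonalizable:
  fixes A :: "real mat"
  assumes "A \<in> carrier_mat n n" and "transpose_mat A = A"
  shows "\<exists>U D. U \<in> carrier_mat n n \<and> D \<in> carrier_mat n n \<and> transpose_mat U * U = 1\<^sub>m n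
    \<and> transpose_mat U * A * U = D \<and> diagonal_mat D"
  using assms
proof (induction n arbitrary: A)
  case 0
  then show ?case
    by (intro exI[of _ "1\<^sub>m 0"] exI[of _ A]) (auto simp: diagonal_mat_def)
next
  case (Suc n A)
  have A: "A \<in> carrier_mat (Suc n) (Suc n)" and sym: "transpose_mat A = A"
    using Suc.prems by auto
  obtain e v where v: "v \<in> carrier_vec (Suc n)" "v \<noteq> 0\<^sub>v (Suc n)" and Av: "A *\<^sub>v v = e \<cdot>\<^sub>v v"
    using symmetric_real_eigenvalue_exists[OF A sym] A
    unfolding eigenvalue_def eigenvector_def by auto
  obtain W c where W: "W \<in> carrier_mat (Suc n) (Suc n)" and WW: "transpose_mat W * W = 1\<^sub>m (Suc n)"
    and W0: "col W 0 = c \<cdot>\<^sub>v v"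
    using orthogonal_matrix_with_first_column[OF v] by blast
  define B where "B = transpose_mat W * A * W"
  have B: "B \<in> carrier_mat (Suc n) (Suc n)" using W A by (auto simp: B_def)
  have symB: "transpose_mat B = B"
    using A W unfolding B_def
    by (simp add: transpose_mult[of _ "Suc n" "Suc n" _ "Suc n"] sym assoc_mult_mat[of _ "Suc n" "Suc n" _ "Suc n" _ "Suc n"])
  have Bsym: "B $$ (i, j) = B $$ (j, i)" if "i < Suc n" "j < Suc n" for i j
    using that B arg_cong[OF symB, of "\<lambda>B. B $$ (j, i)"] by auto
  have AW0: "A *\<^sub>v col W 0 = e \<cdot>\<^sub>v col W 0"
    unfolding W0 using A v by (simp add: mult_mat_vec[OF A v(1)] Av smult_smult_assoc mult.commute)
  have B0: "B $$ (i, 0) = (if i = 0 then e else 0)" if i: "i < Suc n" for i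
  proof -
    have "B = transpose_mat W * (A * W)" using W A by (simp add: B_def)
    then have "B $$ (i, 0) = col W i \<bullet> col (A * W) 0"
      using W A i by (simp del: col_mult2)
    also have "col (A * W) 0 = A *\<^sub>v col W 0" by (rule col_mult2[OF A W]) simp
    also have "col W i \<bullet> (A *\<^sub>v col W 0) = e * (col W i \<bullet> col W 0)"
      unfolding AW0 using W by simp
    also have "col W i \<bullet> col W 0 = (transpose_mat W * W) $$ (i, 0)"
      using W i by simp
    finally show ?thesis unfolding WW using i by simp
  qed
  define B3 where "B3 = mat n n (\<lambda>(i, j). B $$ (Suc i, Suc j))"
  let ?E = "mat 1 1 (\<lambda>_. e)"
  have B3: "B3 \<in> carrier_mat n n" by (simp add: B3_def)
  have Bblock: "B = four_block_mat ?E (0\<^sub>m 1 n) (0\<^sub>m n 1) B3"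
  proof (rule eq_matI)
    fix i j assume "i < dim_row (four_block_mat ?E (0\<^sub>m 1 n) (0\<^sub>m n 1) B3)"
      "j < dim_col (four_block_mat ?E (0\<^sub>m 1 n) (0\<^sub>m n 1) B3)"
    then have "i < Suc n" "j < Suc n" using B3 by auto
    then show "B $$ (i, j) = four_block_mat ?E (0\<^sub>m 1 n) (0\<^sub>m n 1) B3 $$ (i, j)"
      using B0[of i] B0[of j] Bsym[of i j] B3
      by (cases i; cases j) (auto simp: B3_def)
  qed (use B B3 in auto)
  have "transpose_mat B3 = B3"
    by (rule eq_matI) (auto simp: B3_def Bsym)
  from Suc.IH[OF B3 this] obtain U D where U: "U \<in> carrier_mat n n" and D: "D \<in> carrier_mat n n"
    and UU: "transpose_mat U * U = 1\<^sub>m n" and UBU: "transpose_mat U * B3 * U = D"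
    and diag: "diagonal_mat D" by blast
  define U' where "U' = four_block_mat (1\<^sub>m 1) (0\<^sub>m 1 n) (0\<^sub>m n 1) U"
  define D' where "D' = four_block_mat ?E (0\<^sub>m 1 n) (0\<^sub>m n 1) D"
  have U': "U' \<in> carrier_mat (Suc n) (Suc n)" using U by (auto simp: U'_def)
  have D': "D' \<in> carrier_mat (Suc n) (Suc n)" using D by (auto simp: D'_def)
  have tU': "transpose_mat U' = four_block_mat (1\<^sub>m 1) (0\<^sub>m 1 n) (0\<^sub>m n 1) (transpose_mat U)"
    unfolding U'_def using U by (subst transpose_four_block_mat[of _ 1 1 _ n _ n]) auto
  have UU': "transpose_mat U' * U' = 1\<^sub>m (Suc n)"
  proof -
    have "transpose_mat U' * U' = four_block_mat (1\<^sub>m 1) (0\<^sub>m 1 n) (0\<^sub>m n 1) (1\<^sub>m n)"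
      unfolding tU' unfolding U'_def using U UU
      by (subst mult_four_block_mat[of _ 1 1 _ n _ n _ _ 1 _ n]) auto
    also have "\<dots> = 1\<^sub>m (Suc n)" by (rule eq_matI) auto
    finally show ?thesis .
  qed
  have UBU': "transpose_mat U' * B * U' = D'"
  proof -
    have "transpose_mat U' * B = four_block_mat ?E (0\<^sub>m 1 n) (0\<^sub>m n 1) (transpose_mat U * B3)"
      unfolding tU' Bblock using U B3
      by (subst mult_four_block_mat[of _ 1 1 _ n _ n _ _ 1 _ n]) auto
    then show ?thesis
      unfolding U'_def D'_def using U B3 UBU
      by (simp, subst mult_four_block_mat[of _ 1 1 _ n _ n _ _ 1 _ n]) auto
  qed
  have diag': "diagonal_mat D'"
    using diag D unfolding diagonal_mat_def D'_def by auto
  let ?V = "W * U'"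
  have V: "?V \<in> carrier_mat (Suc n) (Suc n)" using W U' by auto
  note assoc = assoc_mult_mat[of _ "Suc n" "Suc n" _ "Suc n" _ "Suc n"]
  have tV: "transpose_mat ?V = transpose_mat U' * transpose_mat W"
    using W U' by (rule transpose_mult)
  have "transpose_mat ?V * ?V = transpose_mat U' * (transpose_mat W * W) * U'"
    unfolding tV using W U' by (simp add: assoc)
  then have VV: "transpose_mat ?V * ?V = 1\<^sub>m (Suc n)"
    unfolding WW using U' UU' by simp
  have "transpose_mat ?V * A * ?V = transpose_mat U' * B * U'"
    unfolding tV B_def using W U' A by (simp add: assoc)
  then have "transpose_mat ?V * A * ?V = D'" using UBU' by simp
  then show ?case using V D' VV diag' by blast
qed

text \<open>Here \<open>es\<close> is the diagonal of \<open>D\<close> and the \<open>u i\<close>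
  are the columns of \<open>U\<close>. The last two claims, Parseval's identity and the diagonalised
  quadratic form, let the extremal arguments below work in eigencoordinates.\<close>

lemma symmetric_eigenbasis:
  fixes A :: "real mat"
  assumes A: "A \<in> carrier_mat n n" and sym: "transpose_mat A = A"
  obtains es :: "real list" and u :: "nat \<Rightarrow> real vec" where
    "length es = n" "char_poly A = (\<Prod>e\<leftarrow>es. [:- e, 1:])"
    "\<And>i. i < n \<Longrightarrow> u i \<in> carrier_vec n"
    "\<And>i. i < n \<Longrightarrow> A *\<^sub>v u i = es ! i \<cdot>\<^sub>v u i"
    "\<And>i j. i < n \<Longrightarrow> j < n \<Longrightarrow> u i \<bullet> u j = (if i = j then 1 else 0)"
    "\<And>x y. x \<in> carrier_vec n \<Longrightarrow> y \<in> carrier_vec n \<Longrightarrow> x \<bullet> y = (\<Sum>i<n. (u i \<bullet> x) * (u i \<bullet> y))"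
    "\<And>x. x \<in> carrier_vec n \<Longrightarrow> x \<bullet> (A *\<^sub>v x) = (\<Sum>i<n. es ! i * (u i \<bullet> x)\<^sup>2)"
proof -
  obtain U D where U: "U \<in> carrier_mat n n" and D: "D \<in> carrier_mat n n"
    and UU: "transpose_mat U * U = 1\<^sub>m n" and UAU: "transpose_mat U * A * U = D"
    and diag: "diagonal_mat D"
    using symmetric_orthogonally_diagonalizable[OF A sym] by blast
  let ?T = "transpose_mat U"
  have T: "?T \<in> carrier_mat n n" using U by simp
  \<comment> \<open>For square matrices a left inverse is a right inverse. This completeness of the
    columns is what yields Parseval's identity in \<open>pars\<close>.\<close>
  have UT: "U * ?T = 1\<^sub>m n" by (rule mat_mult_left_right_inverse[OF T U UU])
  note assoc = assoc_mult_mat[of _ n n _ n _ n]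
  have AU: "A * U = U * D"
  proof -
    have "U * D = (U * ?T) * (A * U)" unfolding UAU[symmetric] using U A by (simp add: assoc)
    then show ?thesis using UT U A by simp
  qed
  have Aeq: "A = U * D * ?T"
  proof -
    have "U * D * ?T = A * (U * ?T)" unfolding AU[symmetric] using U A by (simp add: assoc)
    then show ?thesis using UT A by simp
  qed
  have sim: "similar_mat A D"
    unfolding similar_mat_def
    using similar_mat_witI[OF UT UU Aeq A D U T] by blast
  have upper: "upper_triangular D" using diag D by (auto simp: diagonal_mat_def)
  define es where "es = diag_mat D"
  define u where "u i = col U i" for i
  have len: "length es = n" using D by (simp add: es_def diag_mat_def)
  have es: "es ! i = D $$ (i, i)" if "i < n" for i using that D by (simp add: es_def diag_mat_def)
  have cp: "char_poly A = (\<Prod>e\<leftarrow>es. [:- e, 1:])"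
    unfolding es_def char_poly_similar[OF sim] by (rule char_poly_upper_triangular[OF D upper])
  have u: "u i \<in> carrier_vec n" if "i < n" for i
    unfolding u_def using U by (rule col_carrier_vec[OF that])
  have Tx: "(?T *\<^sub>v x) $ i = u i \<bullet> x" if "i < n" for i x using that U by (simp add: u_def)
  have pars: "x \<bullet> y = (\<Sum>i<n. (u i \<bullet> x) * (u i \<bullet> y))"
    if x: "x \<in> carrier_vec n" and y: "y \<in> carrier_vec n" for x y
  proof -
    have "x \<bullet> y = x \<bullet> ((U * ?T) *\<^sub>v y)" using UT y by simp
    also have "\<dots> = (?T *\<^sub>v x) \<bullet> (?T *\<^sub>v y)"
      using assoc_mult_mat_vec[OF U T y] transpose_vec_mult_scalar[OF U _ x, of "?T *\<^sub>v y"] T y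
      by simp
    also have "\<dots> = (\<Sum>i<n. (u i \<bullet> x) * (u i \<bullet> y))"
      using U Tx by (auto simp: scalar_prod_def lessThan_atLeast0 intro!: sum.cong)
    finally show ?thesis .
  qed
  have Au: "A *\<^sub>v u i = es ! i \<cdot>\<^sub>v u i" if i: "i < n" for i
  proof -
    have "A *\<^sub>v u i = col (A * U) i" using col_mult2[OF A U i] by (simp add: u_def)
    also have "\<dots> = U *\<^sub>v col D i" unfolding AU by (rule col_mult2[OF U D i])
    also have "\<dots> = es ! i \<cdot>\<^sub>v u i"
    proof (rule eq_vecI)
      fix j assume "j < dim_vec (es ! i \<cdot>\<^sub>v u i)"
      then have j: "j < n" using u[OF i] by simp
      have "(U *\<^sub>v col D i) $ j = (\<Sum>l<n. U $$ (j, l) * D $$ (l, i))"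
        using U D i j by (simp add: scalar_prod_def lessThan_atLeast0)
      also have "\<dots> = (\<Sum>l<n. if l = i then U $$ (j, i) * D $$ (i, i) else 0)"
        using diag D i by (intro sum.cong) (auto simp: diagonal_mat_def)
      also have "\<dots> = U $$ (j, i) * D $$ (i, i)" using i by simp
      finally show "(U *\<^sub>v col D i) $ j = (es ! i \<cdot>\<^sub>v u i) $ j"
        using U i j es[OF i] by (simp add: u_def)
    qed (use U in \<open>simp add: u_def\<close>)
    finally show ?thesis .
  qed
  have on: "u i \<bullet> u j = (if i = j then 1 else 0)" if "i < n" "j < n" for i j
    using arg_cong[OF UU, of "\<lambda>M. M $$ (i, j)"] that U by (simp add: u_def)
  have quad: "x \<bullet> (A *\<^sub>v x) = (\<Sum>i<n. es ! i * (u i \<bullet> x)\<^sup>2)" if x: "x \<in> carrier_vec n" for x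
  proof -
    have "u i \<bullet> (A *\<^sub>v x) = es ! i * (u i \<bullet> x)" if i: "i < n" for i
    proof -
      have "u i \<bullet> (A *\<^sub>v x) = (A *\<^sub>v u i) \<bullet> x"
        using transpose_vec_mult_scalar[OF A x u[OF i]] unfolding sym by simp
      then show ?thesis using Au[OF i] u[OF i] x by simp
    qed
    then show ?thesis
      using pars[of x "A *\<^sub>v x"] x A by (simp add: power2_eq_square mult_ac)
  qed
  show thesis
    by (rule that[OF len cp u Au on pars quad])
qed

section \<open>Min-max bounds for the second smallest eigenvalue\<close>

text \<open>Both sides say that at most one entry lies below \<open>c\<close>. Comparing positions
  rather than values counts repeated entries with multiplicity.\<close>

lemma sort_nth_1_ge_iff:
  fixes es :: "'a::linorder list"
  assumes "length es \<ge> 2"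
  shows "sort es ! 1 \<ge> c \<longleftrightarrow> (\<forall>i<length es. \<forall>j<length es. es ! i < c \<longrightarrow> es ! j < c \<longrightarrow> i = j)"
proof -
  obtain a b s where s: "sort es = a # b # s"
    using assms by (metis One_nat_def Suc_1 Suc_le_length_iff length_sort)
  have sorted: "a \<le> b" "\<forall>x\<in>set s. b \<le> x" using arg_cong[OF s, of sorted] by auto
  have "card {i. i < length es \<and> es ! i < c} = length (filter (\<lambda>e. e < c) es)"
    by (simp add: length_filter_conv_card)
  also have "\<dots> = length (filter (\<lambda>e. e < c) (sort es))"
    by (metis mset_filter mset_sort size_mset)
  finally have card: "card {i. i < length es \<and> es ! i < c} = length (filter (\<lambda>e. e < c) (a # b # s))"
    unfolding s .
  have "b \<ge> c \<longleftrightarrow> length (filter (\<lambda>e. e < c) (a # b # s)) \<le> 1"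
  proof
    assume "b \<ge> c"
    then have "filter (\<lambda>e. e < c) s = []" using sorted by (force simp: filter_empty_conv)
    then show "length (filter (\<lambda>e. e < c) (a # b # s)) \<le> 1" using \<open>b \<ge> c\<close> by (auto dest: leD)
  next
    assume "length (filter (\<lambda>e. e < c) (a # b # s)) \<le> 1"
    then show "b \<ge> c" using sorted by (cases "a < c"; cases "b < c") auto
  qed
  also have "\<dots> \<longleftrightarrow> (\<forall>i<length es. \<forall>j<length es. es ! i < c \<longrightarrow> es ! j < c \<longrightarrow> i = j)"
    unfolding card[symmetric] One_nat_def by (subst card_le_Suc0_iff_eq) auto
  finally show ?thesis unfolding s by simp
qed

lemma sorted_proots_linear_factors:
  "sorted_list_of_multiset (proots (\<Prod>e\<leftarrow>es. [:- e, 1:])) = sort (es :: real list)"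
proof -
  have "proots (\<Prod>e\<leftarrow>es. [:- e, 1:]) = mset es"
    by (induction es) (simp_all add: proots_mult prod_list_zero_iff image_iff del: mult_pCons_left)
  then show ?thesis by simp
qed

text \<open>As \<open>c > 0\<close>, the kernel vector \<open>v\<close> exhibits an eigenvalue below
  \<open>c\<close>, and there is room for only one such index \<open>l\<close>. Hence
  \<open>v\<close> is a multiple of \<open>u l\<close>, orthogonality to \<open>v\<close> removes
  the \<open>l\<close>-th coordinate of \<open>x\<close>, and the remaining eigenvalues are at least
  \<open>c\<close>.\<close>

lemma rayleigh_second_eigenvalue_le:
  fixes A :: "real mat"
  assumes A: "A \<in> carrier_mat n n" and sym: "transpose_mat A = A" and n: "n \<ge> 2"
    and ge: "sorted_list_of_multiset (proots (char_poly A)) ! 1 \<ge> c" and c: "c > 0"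
    and v: "v \<in> carrier_vec n" "v \<noteq> 0\<^sub>v n" and Av: "A *\<^sub>v v = 0\<^sub>v n"
    and x: "x \<in> carrier_vec n" and xv: "x \<bullet> v = 0"
  shows "c * (x \<bullet> x) \<le> x \<bullet> (A *\<^sub>v x)"
proof -
  obtain es u where len: "length es = n" and cp: "char_poly A = (\<Prod>e\<leftarrow>es. [:- e, 1:])"
    and u: "\<And>i. i < n \<Longrightarrow> u i \<in> carrier_vec n"
    and Au: "\<And>i. i < n \<Longrightarrow> A *\<^sub>v u i = es ! i \<cdot>\<^sub>v u i"
    and on: "\<And>i j. i < n \<Longrightarrow> j < n \<Longrightarrow> u i \<bullet> u j = (if i = j then 1 else 0)"
    and pars: "\<And>x y. x \<in> carrier_vec n \<Longrightarrow> y \<in> carrier_vec n \<Longrightarrow> x \<bullet> y = (\<Sum>i<n. (u i \<bullet> x) * (u i \<bullet> y))"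
    and quad: "\<And>x. x \<in> carrier_vec n \<Longrightarrow> x \<bullet> (A *\<^sub>v x) = (\<Sum>i<n. es ! i * (u i \<bullet> x)\<^sup>2)"
    by (rule symmetric_eigenbasis[OF A sym], rule that)
  have uniq: "i = j" if "i < n" "j < n" "es ! i < c" "es ! j < c" for i j
    using ge n that unfolding cp sorted_proots_linear_factors
    by (subst (asm) sort_nth_1_ge_iff) (auto simp: len)
  have zero: "es ! i * (u i \<bullet> v) = 0" if i: "i < n" for i
  proof -
    have "es ! i * (u i \<bullet> v) = (A *\<^sub>v u i) \<bullet> v" using Au[OF i] u[OF i] v by simp
    also have "\<dots> = u i \<bullet> (A *\<^sub>v v)"
      using transpose_vec_mult_scalar[OF A v(1) u[OF i]] unfolding sym .
    finally show ?thesis using Av u[OF i] by simp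
  qed
  have "v \<bullet> v \<noteq> 0"
  proof -
    obtain i where i: "i < n" "v $ i \<noteq> 0"
      using v by (metis carrier_vecD dim_vec eq_vecI index_zero_vec)
    then have "(\<Sum>i<n. v $ i * v $ i) > 0" by (intro sum_pos2[of _ i]) (auto simp: less_le)
    then show ?thesis using v by (simp add: scalar_prod_def lessThan_atLeast0)
  qed
  then obtain l where l: "l < n" "u l \<bullet> v \<noteq> 0"
    unfolding pars[OF v(1) v(1)] by (force elim: sum.not_neutral_contains_not_neutral)
  have es: "es ! i \<ge> c" if "i < n" "i \<noteq> l" for i
    using uniq[of i l] zero[OF l(1)] l c that by force
  have "x \<bullet> v = (\<Sum>i<n. if i = l then (u l \<bullet> x) * (u l \<bullet> v) else 0)"
    unfolding pars[OF x v(1)] using zero es c by (intro sum.cong) force+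
  then have ux: "u l \<bullet> x = 0" using xv l by simp
  have "c * (x \<bullet> x) = (\<Sum>i<n. c * (u i \<bullet> x)\<^sup>2)"
    unfolding pars[OF x x] by (simp add: sum_distrib_left power2_eq_square)
  also have "\<dots> \<le> x \<bullet> (A *\<^sub>v x)"
    unfolding quad[OF x]
  proof (rule sum_mono)
    fix i assume "i \<in> {..<n}"
    then show "c * (u i \<bullet> x)\<^sup>2 \<le> es ! i * (u i \<bullet> x)\<^sup>2"
      using es[of i] ux by (cases "i = l") (auto intro: mult_right_mono)
  qed
  finally show ?thesis .
qed

text \<open>If two eigenvectors had eigenvalues below \<open>c\<close>, the plane they span would
  meet the hyperplane orthogonal to \<open>a\<close> in a nonzero vector with Rayleigh quotient
  below \<open>c\<close>.\<close>

lemma second_eigenvalue_geI: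
  fixes A :: "real mat"
  assumes A: "A \<in> carrier_mat n n" and sym: "transpose_mat A = A" and n: "n \<ge> 2"
    and a: "a \<in> carrier_vec n"
    and ge: "\<And>x. x \<in> carrier_vec n \<Longrightarrow> x \<bullet> a = 0 \<Longrightarrow> c * (x \<bullet> x) \<le> x \<bullet> (A *\<^sub>v x)"
  shows "sorted_list_of_multiset (proots (char_poly A)) ! 1 \<ge> c"
proof -
  obtain es u where len: "length es = n" and cp: "char_poly A = (\<Prod>e\<leftarrow>es. [:- e, 1:])"
    and u: "\<And>i. i < n \<Longrightarrow> u i \<in> carrier_vec n"
    and Au: "\<And>i. i < n \<Longrightarrow> A *\<^sub>v u i = es ! i \<cdot>\<^sub>v u i"
    and on: "\<And>i j. i < n \<Longrightarrow> j < n \<Longrightarrow> u i \<bullet> u j = (if i = j then 1 else 0)"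
    and pars: "\<And>x y. x \<in> carrier_vec n \<Longrightarrow> y \<in> carrier_vec n \<Longrightarrow> x \<bullet> y = (\<Sum>i<n. (u i \<bullet> x) * (u i \<bullet> y))"
    and quad: "\<And>x. x \<in> carrier_vec n \<Longrightarrow> x \<bullet> (A *\<^sub>v x) = (\<Sum>i<n. es ! i * (u i \<bullet> x)\<^sup>2)"
    by (rule symmetric_eigenbasis[OF A sym], rule that)
  have "i = j" if i: "i < n" and j: "j < n" and lt: "es ! i < c" "es ! j < c" for i j
  proof (rule ccontr)
    assume ne: "i \<noteq> j"
    \<comment> \<open>One linear equation in two unknowns; the case distinction ensures a nontrivial
      solution.\<close>
    obtain p q where pq: "p \<noteq> 0 \<or> q \<noteq> 0" and orth: "p * (u i \<bullet> a) + q * (u j \<bullet> a) = 0"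
    proof (cases "u i \<bullet> a = 0")
      case True
      then show ?thesis using that[of 1 0] by simp
    next
      case False
      then show ?thesis using that[of "- (u j \<bullet> a)" "u i \<bullet> a"] by simp
    qed
    note ui = u[OF i] and uj = u[OF j]
    \<comment> \<open>The second pair of coefficients is free so that one identity evaluates both
      \<open>?x \<bullet> ?x\<close> and \<open>?x \<bullet> (A *\<^sub>v ?x)\<close>.\<close>
    have comb: "(p \<cdot>\<^sub>v u i + q \<cdot>\<^sub>v u j) \<bullet> (s \<cdot>\<^sub>v u i + t \<cdot>\<^sub>v u j) = p * s + q * t" for s t
      using ui uj ne i j
      by (simp add: add_scalar_prod_distrib[of _ n] scalar_prod_add_distrib[of _ n] on)
    let ?x = "p \<cdot>\<^sub>v u i + q \<cdot>\<^sub>v u j"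
    have x: "?x \<in> carrier_vec n" using ui uj by simp
    have "?x \<bullet> a = 0" using orth ui uj a by (simp add: add_scalar_prod_distrib[of _ n])
    then have "c * (?x \<bullet> ?x) \<le> ?x \<bullet> (A *\<^sub>v ?x)" by (rule ge[OF x])
    moreover have "A *\<^sub>v ?x = (p * es ! i) \<cdot>\<^sub>v u i + (q * es ! j) \<cdot>\<^sub>v u j"
      using A ui uj Au[OF i] Au[OF j]
      by (simp add: mult_add_distrib_mat_vec[of _ n n] mult_mat_vec[of _ n n] smult_smult_assoc)
    ultimately have "c * (p\<^sup>2 + q\<^sup>2) \<le> es ! i * p\<^sup>2 + es ! j * q\<^sup>2"
      by (simp add: comb power2_eq_square algebra_simps)
    then have "(c - es ! i) * p\<^sup>2 + (c - es ! j) * q\<^sup>2 \<le> 0" by (simp add: algebra_simps)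
    moreover have "(c - es ! i) * p\<^sup>2 \<ge> 0" "(c - es ! j) * q\<^sup>2 \<ge> 0" using lt by auto
    ultimately have "(c - es ! i) * p\<^sup>2 = 0" "(c - es ! j) * q\<^sup>2 = 0" by linarith+
    then show False using lt pq by simp
  qed
  then show ?thesis
    unfolding cp sorted_proots_linear_factors using n by (subst sort_nth_1_ge_iff) (auto simp: len)
qed

section \<open>Energy and Laplacian\<close>

lemma simple_graph_finite_edges:
  "simple_graph G \<Longrightarrow> finite (edges G)"
  by (rule finite_subset[of _ "Pow (verts G)"]) (auto simp: simple_graph_def)

lemma edge_finite:
  "simple_graph G \<Longrightarrow> e \<in> edges G \<Longrightarrow> finite e"
  using finite_subset[of e "verts G"] by (simp add: simple_graph_def)

lemma vertex_list:
  assumes "simple_graph G"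
  shows "distinct (vertex_list G)" "set (vertex_list G) = verts G"
    "length (vertex_list G) = card (verts G)"
proof -
  have "\<exists>vs. distinct vs \<and> set vs = verts G"
    using assms finite_distinct_list[of "verts G"] by (auto simp: simple_graph_def)
  then have "distinct (vertex_list G) \<and> set (vertex_list G) = verts G"
    unfolding vertex_list_def by (rule someI_ex)
  then show "distinct (vertex_list G)" "set (vertex_list G) = verts G"
    "length (vertex_list G) = card (verts G)" using distinct_card[of "vertex_list G"] by simp_all
qed

lemma bij_betw_vertex_list:
  "simple_graph G \<Longrightarrow> bij_betw ((!) (vertex_list G)) {..<card (verts G)} (verts G)"
  by (intro bij_betw_nth) (simp_all add: vertex_list)

lemma card_edges_through_pair:
  assumes "simple_graph G" "a \<noteq> b"
  shows "card {e \<in> edges G. a \<in> e \<and> b \<in> e} = (if {a, b} \<in> edges G then 1 else 0)"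
proof -
  have "e = {a, b}" if "e \<in> edges G" "a \<in> e" "b \<in> e" for e
  proof -
    have "card e = 2" using assms(1) that(1) by (simp add: simple_graph_def)
    then obtain c d where "e = {c, d}" by (auto simp: card_2_iff)
    then show ?thesis using that(2,3) assms(2) by blast
  qed
  then have "{e \<in> edges G. a \<in> e \<and> b \<in> e} = {e. e = {a, b} \<and> e \<in> edges G}" by blast
  then show ?thesis by (simp add: Collect_conv_if)
qed

lemma no_loop:
  assumes "simple_graph G"
  shows "{a} \<notin> edges G"
proof
  assume "{a} \<in> edges G"
  then have "card {a} = 2" using assms unfolding simple_graph_def by blast
  then show False by simp
qed

lemma vertex_degree_eq_card_neighbours:
  assumes G: "simple_graph G"
  shows "vertex_degree G a = card {b \<in> verts G. {a, b} \<in> edges G}"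
proof -
  have "{e \<in> edges G. a \<in> e} = (\<lambda>b. {a, b}) ` {b \<in> verts G. {a, b} \<in> edges G}"
  proof (intro subset_antisym subsetI)
    fix e assume e: "e \<in> {e \<in> edges G. a \<in> e}"
    then have "card e = 2" "e \<subseteq> verts G" using G by (auto simp: simple_graph_def)
    then obtain b where "e = {a, b}" "b \<in> verts G" using e by (auto simp: card_2_iff)
    then show "e \<in> (\<lambda>b. {a, b}) ` {b \<in> verts G. {a, b} \<in> edges G}" using e by auto
  qed auto
  moreover have "inj_on (\<lambda>b. {a, b}) S" for S by (auto simp: inj_on_def doubleton_eq_iff)
  ultimately show ?thesis unfolding vertex_degree_def by (simp add: card_image)
qed

lemma sum_edges_incident:
  fixes h :: "'a \<Rightarrow> real"
  assumes G: "simple_graph G"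
  shows "(\<Sum>e\<in>edges G. \<Sum>v\<in>e. h v) = (\<Sum>v\<in>verts G. real (vertex_degree G v) * h v)"
proof -
  have fin: "finite (verts G)" and sub: "\<And>e. e \<in> edges G \<Longrightarrow> e \<subseteq> verts G"
    using G by (auto simp: simple_graph_def)
  have "(\<Sum>e\<in>edges G. \<Sum>v\<in>e. h v) = (\<Sum>e\<in>edges G. \<Sum>v | v \<in> verts G \<and> v \<in> e. h v)"
    using sub by (intro sum.cong) auto
  also have "\<dots> = (\<Sum>v\<in>verts G. \<Sum>e | e \<in> edges G \<and> v \<in> e. h v)"
    by (rule sum.swap_restrict[OF simple_graph_finite_edges[OF G] fin])
  finally show ?thesis by (simp add: vertex_degree_def)
qed

section \<open>Dirichlet energy\<close>

text \<open>For \<open>e = {a, b}\<close> this is \<open>(x a - x b)\<^sup>2\<close>, written symmetrically in the end-vertices.\<close>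

definition edge_energy :: "('a \<Rightarrow> real) \<Rightarrow> 'a set \<Rightarrow> real" where
  "edge_energy x e = 2 * (\<Sum>v\<in>e. (x v)\<^sup>2) - (\<Sum>v\<in>e. x v)\<^sup>2"

definition energy :: "'a ugraph \<Rightarrow> ('a \<Rightarrow> real) \<Rightarrow> real" where
  "energy G x = (\<Sum>e\<in>edges G. edge_energy x e)"

lemma edge_energy_doubleton: "a \<noteq> b \<Longrightarrow> edge_energy x {a, b} = (x a - x b)\<^sup>2"
  by (simp add: edge_energy_def power2_eq_square algebra_simps)

lemma edge_energy_nonneg: "card e = 2 \<Longrightarrow> edge_energy x e \<ge> 0"
  by (auto simp: card_2_iff edge_energy_doubleton)

lemma edge_energy_image: "inj_on h e \<Longrightarrow> edge_energy x (h ` e) = edge_energy (x \<circ> h) e"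
  by (simp add: edge_energy_def sum.reindex)

text \<open>This is the quadratic form of the signless Laplacian, degree plus adjacency matrix. Each
  square is expanded over ordered pairs and the summations are exchanged: a diagonal pair is counted
  degree many times, an off-diagonal pair at most once.\<close>

lemma sum_square_edge_sums:
  assumes G: "simple_graph G"
  shows "(\<Sum>e\<in>edges G. (\<Sum>v\<in>e. x v)\<^sup>2) =
    (\<Sum>v\<in>verts G. real (vertex_degree G v) * (x v)\<^sup>2)
    + (\<Sum>a\<in>verts G. \<Sum>b\<in>verts G. (if {a, b} \<in> edges G then 1 else 0) * (x a * x b))"
proof -
  have fin: "finite (verts G)" and sub: "\<And>e. e \<in> edges G \<Longrightarrow> e \<subseteq> verts G"
    using G by (auto simp: simple_graph_def)
  have finE: "finite (edges G)" by (rule simple_graph_finite_edges[OF G])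
  have "(\<Sum>e\<in>edges G. (\<Sum>v\<in>e. x v)\<^sup>2)
      = (\<Sum>e\<in>edges G. \<Sum>p\<in>e \<times> e. x (fst p) * x (snd p))"
    by (simp add: power2_eq_square sum_product sum.cartesian_product case_prod_beta)
  also have "\<dots> = (\<Sum>e\<in>edges G. \<Sum>p | p \<in> verts G \<times> verts G \<and> p \<in> e \<times> e. x (fst p) * x (snd p))"
    using sub by (intro sum.cong) auto
  also have "\<dots> = (\<Sum>p\<in>verts G \<times> verts G. \<Sum>e | e \<in> edges G \<and> p \<in> e \<times> e. x (fst p) * x (snd p))"
    by (rule sum.swap_restrict) (use finE fin in auto)
  also have "\<dots> = (\<Sum>a\<in>verts G. \<Sum>b\<in>verts G. card {e \<in> edges G. a \<in> e \<and> b \<in> e} * (x a * x b))"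
    by (simp add: sum.cartesian_product case_prod_beta mem_Times_iff)
  also have "\<dots> = (\<Sum>a\<in>verts G. \<Sum>b\<in>verts G. (if b = a then real (vertex_degree G a) * (x a)\<^sup>2 else 0)
      + (if {a, b} \<in> edges G then 1 else 0) * (x a * x b))"
    using card_edges_through_pair[OF G] no_loop[OF G]
    by (intro sum.cong refl) (auto simp: vertex_degree_def power2_eq_square)
  finally show ?thesis using fin by (simp add: sum.distrib)
qed

section \<open>The Laplacian as the matrix of the energy\<close>

lemma laplacian_carrier: "laplacian G \<in> carrier_mat (card (verts G)) (card (verts G))"
  unfolding laplacian_def degree_matrix_def adjacency_matrix_def
  by (rule minus_carrier_mat) simp

lemma laplacian_index:
  assumes "i < card (verts G)" "j < card (verts G)"
  shows "laplacian G $$ (i, j) = (if i = j then real (vertex_degree G (vertex_list G ! i)) else 0)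
    - (if {vertex_list G ! i, vertex_list G ! j} \<in> edges G then 1 else 0)"
  using assms by (simp add: laplacian_def degree_matrix_def adjacency_matrix_def)

lemma laplacian_symmetric: "transpose_mat (laplacian G) = laplacian G"
  by (rule eq_matI) (simp_all add: carrier_matD[OF laplacian_carrier] laplacian_index insert_commute)

text \<open>Coordinates of a function in the enumeration that indexes the Laplacian. They translate
  matrix statements into sums over vertices, where the enumeration no longer occurs.\<close>

definition vertex_vec :: "'a ugraph \<Rightarrow> ('a \<Rightarrow> real) \<Rightarrow> real vec" where
  "vertex_vec G x = vec (card (verts G)) (\<lambda>i. x (vertex_list G ! i))"

lemma vertex_vec_carrier [simp]: "vertex_vec G x \<in> carrier_vec (card (verts G))"
  by (simp add: vertex_vec_def)

lemma sum_vertex_list: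
  fixes h :: "'a \<Rightarrow> real"
  shows "simple_graph G \<Longrightarrow> (\<Sum>i<card (verts G). h (vertex_list G ! i)) = (\<Sum>v\<in>verts G. h v)"
  by (rule sum.reindex_bij_betw[OF bij_betw_vertex_list])

lemma scalar_prod_vertex_vec:
  assumes "simple_graph G"
  shows "vertex_vec G x \<bullet> vertex_vec G y = (\<Sum>v\<in>verts G. x v * y v)"
  using sum_vertex_list[OF assms, of "\<lambda>v. x v * y v"]
  by (simp add: vertex_vec_def scalar_prod_def lessThan_atLeast0)

lemma vertex_vec_surj:
  assumes G: "simple_graph G" and w: "w \<in> carrier_vec (card (verts G))"
  obtains x where "w = vertex_vec G x"
proof -
  let ?i = "the_inv_into {..<card (verts G)} ((!) (vertex_list G))"
  have "w = vertex_vec G (\<lambda>v. w $ ?i v)"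
    using w bij_betw_vertex_list[OF G]
    by (intro eq_vecI) (auto simp: vertex_vec_def the_inv_into_f_f bij_betw_def)
  then show ?thesis by (rule that)
qed

lemma laplacian_mult_vertex_vec:
  assumes G: "simple_graph G"
  shows "laplacian G *\<^sub>v vertex_vec G x = vertex_vec G (\<lambda>a. real (vertex_degree G a) * x a
    - (\<Sum>b\<in>verts G. (if {a, b} \<in> edges G then 1 else 0) * x b))"
proof (rule eq_vecI)
  let ?vs = "vertex_list G"
  fix i assume "i < dim_vec (vertex_vec G (\<lambda>a. real (vertex_degree G a) * x a
    - (\<Sum>b\<in>verts G. (if {a, b} \<in> edges G then 1 else 0) * x b)))"
  then have i: "i < card (verts G)" by (simp add: vertex_vec_def)
  have "(laplacian G *\<^sub>v vertex_vec G x) $ i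
      = (\<Sum>j<card (verts G). laplacian G $$ (i, j) * x (?vs ! j))"
    using i laplacian_carrier[of G] by (simp add: vertex_vec_def scalar_prod_def lessThan_atLeast0)
  also have "\<dots> = (\<Sum>j<card (verts G). (if j = i then real (vertex_degree G (?vs ! i)) * x (?vs ! i) else 0)
      - (if {?vs ! i, ?vs ! j} \<in> edges G then 1 else 0) * x (?vs ! j))"
    using i by (intro sum.cong refl) (auto simp: laplacian_index left_diff_distrib)
  also have "\<dots> = real (vertex_degree G (?vs ! i)) * x (?vs ! i)
      - (\<Sum>b\<in>verts G. (if {?vs ! i, b} \<in> edges G then 1 else 0) * x b)"
    using i sum_vertex_list[OF G, of "\<lambda>b. (if {?vs ! i, b} \<in> edges G then 1 else 0) * x b"]
    by (simp add: sum_subtractf)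
  finally show "(laplacian G *\<^sub>v vertex_vec G x) $ i = vertex_vec G (\<lambda>a. real (vertex_degree G a) * x a
    - (\<Sum>b\<in>verts G. (if {a, b} \<in> edges G then 1 else 0) * x b)) $ i"
    using i by (simp add: vertex_vec_def)
qed (simp add: vertex_vec_def carrier_matD[OF laplacian_carrier])

text \<open>The energy is twice the degree form minus the signless Laplacian form, which leaves
  degree minus adjacency.\<close>

lemma laplacian_quadratic_form:
  assumes G: "simple_graph G"
  shows "vertex_vec G x \<bullet> (laplacian G *\<^sub>v vertex_vec G x) = energy G x"
proof -
  have "energy G x = 2 * (\<Sum>e\<in>edges G. \<Sum>v\<in>e. (x v)\<^sup>2) - (\<Sum>e\<in>edges G. (\<Sum>v\<in>e. x v)\<^sup>2)"
    by (simp add: energy_def edge_energy_def sum_subtractf sum_distrib_left)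
  then show ?thesis
    unfolding laplacian_mult_vertex_vec[OF G] scalar_prod_vertex_vec[OF G]
      sum_edges_incident[OF G] sum_square_edge_sums[OF G]
    by (simp add: right_diff_distrib sum_subtractf sum_distrib_left power2_eq_square mult_ac)
qed

lemma laplacian_mult_one:
  assumes G: "simple_graph G"
  shows "laplacian G *\<^sub>v vertex_vec G (\<lambda>_. 1) = 0\<^sub>v (card (verts G))"
proof -
  have fin: "finite (verts G)" using G by (simp add: simple_graph_def)
  have "(\<Sum>b\<in>verts G. if {a, b} \<in> edges G then 1 else 0) = real (vertex_degree G a)" for a
    unfolding vertex_degree_eq_card_neighbours[OF G] using fin
    by (simp flip: sum.inter_filter)
  then show ?thesis
    unfolding laplacian_mult_vertex_vec[OF G] by (auto simp: vertex_vec_def)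
qed

section \<open>Variational bounds for the algebraic connectivity\<close>

lemma energy_ge_algebraic_connectivity:
  assumes G: "simple_graph G" and card: "card (verts G) \<ge> 2"
    and c: "0 < c" "c \<le> algebraic_connectivity G"
    and x: "(\<Sum>v\<in>verts G. x v) = 0"
  shows "c * (\<Sum>v\<in>verts G. (x v)\<^sup>2) \<le> energy G x"
proof -
  \<comment> \<open>The constant function serves as the kernel vector, so orthogonality to it is the
    condition that \<open>x\<close> sums to zero.\<close>
  have "vertex_vec G (\<lambda>_. 1) \<noteq> 0\<^sub>v (card (verts G))"
  proof
    assume "vertex_vec G (\<lambda>_. 1) = 0\<^sub>v (card (verts G))"
    then have "vertex_vec G (\<lambda>_. 1) $ 0 = 0" using card by simp
    then show False using card by (simp add: vertex_vec_def)
  qed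
  moreover have "vertex_vec G x \<bullet> vertex_vec G (\<lambda>_. 1) = 0"
    using x by (simp add: scalar_prod_vertex_vec[OF G])
  ultimately have "c * (vertex_vec G x \<bullet> vertex_vec G x)
      \<le> vertex_vec G x \<bullet> (laplacian G *\<^sub>v vertex_vec G x)"
    using c card laplacian_mult_one[OF G]
    unfolding algebraic_connectivity_def laplacian_eigenvalues_def
    by (intro rayleigh_second_eigenvalue_le[OF laplacian_carrier laplacian_symmetric]) auto
  then show ?thesis
    by (simp add: laplacian_quadratic_form[OF G] scalar_prod_vertex_vec[OF G] power2_eq_square)
qed

text \<open>The weight \<open>a\<close> is left free because the corona argument uses a weight that
  vanishes on the copies of \<open>H\<close>, so its hyperplane is not the complement of the
  constants.\<close>

lemma algebraic_connectivity_geI: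
  assumes G: "simple_graph G" and card: "card (verts G) \<ge> 2"
    and ge: "\<And>x. (\<Sum>v\<in>verts G. x v * a v) = 0 \<Longrightarrow> c * (\<Sum>v\<in>verts G. (x v)\<^sup>2) \<le> energy G x"
  shows "c \<le> algebraic_connectivity G"
  unfolding algebraic_connectivity_def laplacian_eigenvalues_def
proof (rule second_eigenvalue_geI[OF laplacian_carrier laplacian_symmetric card])
  show "vertex_vec G a \<in> carrier_vec (card (verts G))" by simp
  fix w assume w: "w \<in> carrier_vec (card (verts G))" "w \<bullet> vertex_vec G a = 0"
  obtain x where x: "w = vertex_vec G x" using vertex_vec_surj[OF G w(1)] .
  show "c * (w \<bullet> w) \<le> w \<bullet> (laplacian G *\<^sub>v w)"
    using ge[of x] w(2) unfolding x
    by (simp add: laplacian_quadratic_form[OF G] scalar_prod_vertex_vec[OF G] power2_eq_square)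
qed

section \<open>Edge corona\<close>

lemma not_complete_nonadjacent:
  assumes "simple_graph G" "\<not> complete_graph G"
  obtains a b where "a \<in> verts G" "b \<in> verts G" "a \<noteq> b" "{a, b} \<notin> edges G"
proof -
  obtain e where e: "e \<subseteq> verts G" "card e = 2" "e \<notin> edges G"
    using assms unfolding simple_graph_def complete_graph_def by blast
  then obtain a b where "e = {a, b}" "a \<noteq> b" by (auto simp: card_2_iff)
  with e show ?thesis by (intro that[of a b]) auto
qed

text \<open>For a \<open>k\<close>-regular graph the Laplacian and signless Laplacian forms add up
  to \<open>2 * k\<close> times the squared norm. This converts a lower bound on the energy into an
  upper bound on the squared edge sums.\<close>

lemma regular_energy:
  assumes G: "simple_graph G" and reg: "regular_graph k G"
  shows "energy G x = 2 * real k * (\<Sum>v\<in>verts G. (x v)\<^sup>2) - (\<Sum>e\<in>edges G. (\<Sum>v\<in>e. x v)\<^sup>2)"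
    and "(\<Sum>e\<in>edges G. \<Sum>v\<in>e. (x v)\<^sup>2) = real k * (\<Sum>v\<in>verts G. (x v)\<^sup>2)"
proof -
  show *: "(\<Sum>e\<in>edges G. \<Sum>v\<in>e. (x v)\<^sup>2) = real k * (\<Sum>v\<in>verts G. (x v)\<^sup>2)"
    using reg by (simp add: sum_edges_incident[OF G] regular_graph_def sum_distrib_left)
  have "energy G x = 2 * (\<Sum>e\<in>edges G. \<Sum>v\<in>e. (x v)\<^sup>2) - (\<Sum>e\<in>edges G. (\<Sum>v\<in>e. x v)\<^sup>2)"
    by (simp add: energy_def edge_energy_def sum_subtractf sum_distrib_left)
  then show "energy G x = 2 * real k * (\<Sum>v\<in>verts G. (x v)\<^sup>2) - (\<Sum>e\<in>edges G. (\<Sum>v\<in>e. x v)\<^sup>2)"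
    unfolding * by simp
qed

text \<open>Test vector: the difference of the indicators of two nonadjacent vertices.\<close>

lemma algebraic_connectivity_le_degree:
  assumes G: "simple_graph G" and reg: "regular_graph k G" and nc: "\<not> complete_graph G"
    and c: "0 < c" "c \<le> algebraic_connectivity G"
  shows "c \<le> real k"
proof -
  obtain a b where ab: "a \<in> verts G" "b \<in> verts G" "a \<noteq> b" "{a, b} \<notin> edges G"
    using not_complete_nonadjacent[OF G nc] .
  have fin: "finite (verts G)" using G by (simp add: simple_graph_def)
  define x :: "'a \<Rightarrow> real" where "x v = (if v = a then 1 else 0) - (if v = b then 1 else 0)" for v
  have sum0: "(\<Sum>v\<in>verts G. x v) = 0" unfolding x_def using ab fin by (simp add: sum_subtractf)
  have "(x v)\<^sup>2 = (if v = a then 1 else 0) + (if v = b then 1 else 0)" for v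
    using ab by (simp add: x_def)
  then have sq: "(\<Sum>v\<in>verts G. (x v)\<^sup>2) = 2" using ab fin by (simp add: sum.distrib)
  \<comment> \<open>The product \<open>x v * x w\<close> is nonzero only for \<open>v\<close>,
    \<open>w\<close> among \<open>a\<close>, \<open>b\<close>. There are no loops and
    \<open>{a, b}\<close> is not an edge, so the adjacency part vanishes.\<close>
  have "(if {v, w} \<in> edges G then 1 else 0) * (x v * x w) = 0" for v w
    using ab no_loop[OF G] by (auto simp: x_def insert_commute)
  then have "(\<Sum>e\<in>edges G. (\<Sum>v\<in>e. x v)\<^sup>2) = (\<Sum>v\<in>verts G. real k * (x v)\<^sup>2)"
    using reg by (simp add: sum_square_edge_sums[OF G] regular_graph_def)
  then have "energy G x = 2 * real k"
    using regular_energy(1)[OF G reg, of x] sq by (simp flip: sum_distrib_left)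
  moreover have "card {a, b} \<le> card (verts G)" using ab fin by (intro card_mono) auto
  ultimately show ?thesis
    using energy_ge_algebraic_connectivity[OF G _ c sum0] sq ab by simp
qed

section \<open>The quadratic equation behind \<open>g_fun\<close>\<close>

text \<open>Here \<open>t\<close> is the smaller root of the quadratic in the last claim. At 2 that
  quadratic has the value \<open>n * (x - 2 * k)\<close>, negative by hypothesis, so 2 lies strictly
  between the roots.\<close>

lemma g_fun_half:
  fixes x :: real and n k :: nat
  assumes x: "0 < x" "x < 2 * real k" and n: "n > 0"
  defines "t \<equiv> g_fun n k x / 2"
  shows "0 < t" "t < 2" "t\<^sup>2 - (x + real n * real k + 2) * t + (real n + 2) * x = 0"
proof -
  define S where "S = x + real n * real k + 2"
  define D where "D = S\<^sup>2 - 4 * (real n + 2) * x"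
  have t: "t = (S - sqrt D) / 2" by (simp add: t_def g_fun_def S_def D_def)
  have S: "S > 0" using x by (simp add: S_def add_pos_nonneg)
  \<comment> \<open>\<open>t < 2\<close> amounts to \<open>S - 4 < sqrt D\<close>, which is why the
    discriminant is compared with the square of \<open>4 - S\<close>.\<close>
  have D_eq: "D = (4 - S)\<^sup>2 + 4 * real n * (2 * real k - x)"
    by (simp add: D_def S_def power2_eq_square algebra_simps)
  have pos: "4 * real n * (2 * real k - x) > 0" using x n by simp
  then have D: "D > (4 - S)\<^sup>2" using D_eq by linarith
  then have D0: "D > 0" using zero_le_power2[of "4 - S"] by linarith
  have "sqrt D < sqrt (S\<^sup>2)"
    unfolding real_sqrt_less_iff using x by (simp add: D_def add_pos_nonneg)
  then show "0 < t" using S by (simp add: t)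
  have "sqrt ((4 - S)\<^sup>2) < sqrt D" using D by (simp only: real_sqrt_less_iff)
  then show "t < 2" by (simp add: t)
  have "(sqrt D)\<^sup>2 = D" using D0 by simp
  then have "t\<^sup>2 - S * t + (S\<^sup>2 - D) / 4 = 0"
    unfolding t by (simp add: power2_eq_square field_simps)
  then show "t\<^sup>2 - (x + real n * real k + 2) * t + (real n + 2) * x = 0"
    by (simp add: D_def S_def field_simps)
qed

section \<open>Energy of a graph containing the edge corona\<close>

lemma sum_corona_vertices:
  assumes "finite (verts G)" "finite (edges G)" "finite (verts H)"
  shows "(\<Sum>w\<in>verts (edge_corona G H). h w) =
    (\<Sum>v\<in>verts G. h (Inl v)) + (\<Sum>e\<in>edges G. \<Sum>u\<in>verts H. h (Inr (e, u)))"
proof -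
  have "(\<Sum>w\<in>verts (edge_corona G H). h w) =
      (\<Sum>w\<in>Inl ` verts G. h w) + (\<Sum>w\<in>Inr ` (edges G \<times> verts H). h w)"
    unfolding edge_corona_def using assms by (simp, intro sum.union_disjoint) auto
  then show ?thesis by (simp add: sum.reindex sum.cartesian_product case_prod_beta)
qed

text \<open>Only the edges of the base graph and those joining it to the copies are kept. Edges
  inside the copies and added edges have nonnegative energy and are dropped.\<close>

lemma corona_supergraph_energy_ge:
  assumes G: "simple_graph G" and H: "finite (verts H)" and G': "simple_graph G'"
    and sub: "edges (edge_corona G H) \<subseteq> edges G'"
  shows "energy G (f \<circ> Inl)
    + (\<Sum>e\<in>edges G. \<Sum>u\<in>verts H. \<Sum>v\<in>e. (f (Inl v) - f (Inr (e, u)))\<^sup>2) \<le> energy G' f"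
proof -
  have finE: "finite (edges G)" and fine: "\<And>e. e \<in> edges G \<Longrightarrow> finite e"
    using simple_graph_finite_edges[OF G] edge_finite[OF G] by auto
  let ?A = "(`) Inl ` edges G"
  \<comment> \<open>\<open>?I\<close> lists the joining edges as triples of a base edge, a vertex of
    \<open>H\<close> and an end of the base edge.\<close>
  let ?I = "Sigma (edges G \<times> verts H) fst"
  let ?j = "\<lambda>((e, u), v). {Inl v, Inr (e, u)}"
  have inj: "inj_on ((`) Inl) (edges G)" by (simp add: inj_on_def inj_image_eq_iff)
  have A: "(\<Sum>d\<in>?A. edge_energy f d) = energy G (f \<circ> Inl)"
    unfolding sum.reindex[OF inj] by (simp add: energy_def edge_energy_image)
  \<comment> \<open>The tags \<open>Inl\<close> and \<open>Inr\<close> recover the triple from the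
    unordered pair.\<close>
  have "inj_on ?j ?I" by (auto simp: inj_on_def doubleton_eq_iff)
  then have "(\<Sum>d\<in>?j ` ?I. edge_energy f d) = (\<Sum>p\<in>?I. edge_energy f (?j p))"
    by (simp add: sum.reindex)
  also have "\<dots> = (\<Sum>((e, u), v)\<in>?I. (f (Inl v) - f (Inr (e, u)))\<^sup>2)"
    by (intro sum.cong) (auto simp: edge_energy_doubleton)
  also have "\<dots> = (\<Sum>p\<in>edges G \<times> verts H. \<Sum>v\<in>fst p. (f (Inl v) - f (Inr p))\<^sup>2)"
    using finE H fine by (subst sum.Sigma) (auto intro!: sum.cong)
  also have "\<dots> = (\<Sum>e\<in>edges G. \<Sum>u\<in>verts H. \<Sum>v\<in>e. (f (Inl v) - f (Inr (e, u)))\<^sup>2)"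
    by (subst sum.cartesian_product) (simp add: case_prod_beta)
  finally have B: "(\<Sum>d\<in>?j ` ?I. edge_energy f d) = \<dots>" .
  have "finite ?I" using finE H fine by (intro finite_SigmaI) auto
  then have fin: "finite ?A" "finite (?j ` ?I)" using finE by simp_all
  have disj: "?A \<inter> ?j ` ?I = {}" by auto
  have "(\<Sum>d\<in>?A \<union> ?j ` ?I. edge_energy f d) =
      energy G (f \<circ> Inl) + (\<Sum>e\<in>edges G. \<Sum>u\<in>verts H. \<Sum>v\<in>e. (f (Inl v) - f (Inr (e, u)))\<^sup>2)"
    unfolding sum.union_disjoint[OF fin disj] A B ..
  moreover have "(\<Sum>d\<in>?A \<union> ?j ` ?I. edge_energy f d) \<le> energy G' f"
    unfolding energy_def
  proof (rule sum_mono2)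
    have "?A \<union> ?j ` ?I \<subseteq> edges (edge_corona G H)" by (auto simp: edge_corona_def)
    then show "?A \<union> ?j ` ?I \<subseteq> edges G'" using sub by (rule subset_trans)
    show "finite (edges G')" by (rule simple_graph_finite_edges[OF G'])
  qed (use G' in \<open>auto simp: simple_graph_def intro: edge_energy_nonneg\<close>)
  ultimately show ?thesis by simp
qed

text \<open>Complete the square in \<open>y\<close>.\<close>

lemma edge_vertex_bound:
  fixes t y :: real
  assumes t: "t < 2" and e: "card e = 2"
  shows "(\<Sum>v\<in>e. (x v)\<^sup>2) - (\<Sum>v\<in>e. x v)\<^sup>2 / (2 - t) + t * y\<^sup>2 \<le> (\<Sum>v\<in>e. (x v - y)\<^sup>2)"
proof -
  let ?s = "\<Sum>v\<in>e. x v"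
  have "(\<Sum>v\<in>e. (x v - y)\<^sup>2) = (\<Sum>v\<in>e. (x v)\<^sup>2) - 2 * y * ?s + 2 * y\<^sup>2"
    using e by (auto simp: card_2_iff power2_eq_square algebra_simps)
  \<comment> \<open>The square vanishes at the minimiser \<open>y = ?s / (2 - t)\<close>;
    \<open>t < 2\<close> makes the expression convex in \<open>y\<close>.\<close>
  moreover have "0 \<le> ((2 - t) * y - ?s)\<^sup>2 / (2 - t)" using t by simp
  moreover have "((2 - t) * y - ?s)\<^sup>2 / (2 - t) = (2 - t) * y\<^sup>2 - 2 * y * ?s + ?s\<^sup>2 / (2 - t)"
    using t by (simp add: field_simps power2_eq_square)
  ultimately show ?thesis by (simp add: algebra_simps)
qed

lemma corona_supergraph_algebraic_connectivity:
  assumes G: "simple_graph G" and reg: "regular_graph k G" and nc: "\<not> complete_graph G"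
    and H: "finite (verts H)" "card (verts H) = n" "n > 0"
    and \<epsilon>: "0 < \<epsilon>" "\<epsilon> \<le> algebraic_connectivity G"
    and G': "simple_graph G'" and V': "verts G' = verts (edge_corona G H)"
    and sub: "edges (edge_corona G H) \<subseteq> edges G'"
  shows "g_fun n k \<epsilon> / 2 \<le> algebraic_connectivity G'"
proof -
  define t where "t = g_fun n k \<epsilon> / 2"
  have le: "\<epsilon> \<le> real k" by (rule algebraic_connectivity_le_degree[OF G reg nc \<epsilon>])
  then have lt: "\<epsilon> < 2 * real k" using \<epsilon>(1) by linarith
  have t: "0 < t" "t < 2" "t\<^sup>2 - (\<epsilon> + real n * real k + 2) * t + (real n + 2) * \<epsilon> = 0"
    using g_fun_half[OF \<epsilon>(1) lt H(3)] by (simp_all add: t_def)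
  have finV: "finite (verts G)" using G by (simp add: simple_graph_def)
  have finE: "finite (edges G)" by (rule simple_graph_finite_edges[OF G])
  note corona_sum = sum_corona_vertices[OF finV finE H(1), folded V']
  \<comment> \<open>Non-completeness supplies two vertices, so position 1 exists in the eigenvalue
    lists of \<open>G\<close> and \<open>G'\<close>.\<close>
  obtain a b where ab: "a \<in> verts G" "b \<in> verts G" "a \<noteq> b"
    using not_complete_nonadjacent[OF G nc] by blast
  have cardV: "card (verts G) \<ge> 2"
    using card_mono[OF finV, of "{a, b}"] ab by simp
  have "finite (verts G')" using G' by (simp add: simple_graph_def)
  then have "card {Inl a :: 'a + 'a set \<times> 'b, Inl b} \<le> card (verts G')"
    using ab by (intro card_mono) (auto simp: V' edge_corona_def)
  then have cardV': "card (verts G') \<ge> 2" using ab by simp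
  show ?thesis
    unfolding t_def[symmetric]
  \<comment> \<open>The weight is the indicator of the base vertices: orthogonality to it makes the
    restriction of \<open>f\<close> to \<open>G\<close> sum to zero, as the bound \<open>QX\<close>
    requires, and leaves the values on the copies free.\<close>
  proof (rule algebraic_connectivity_geI[OF G' cardV', where a = "case_sum (\<lambda>_. 1) (\<lambda>_. 0)"])
    fix f :: "'a + 'a set \<times> 'b \<Rightarrow> real"
    assume "(\<Sum>w\<in>verts G'. f w * case_sum (\<lambda>_. 1) (\<lambda>_. 0) w) = 0"
    then have sum0: "(\<Sum>v\<in>verts G. (f \<circ> Inl) v) = 0" by (simp add: corona_sum)
    define x where "x = f \<circ> Inl"
    define X where "X = (\<Sum>v\<in>verts G. (x v)\<^sup>2)"
    define Y where "Y = (\<Sum>e\<in>edges G. \<Sum>u\<in>verts H. (f (Inr (e, u)))\<^sup>2)"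
    define Q where "Q = energy G x"
    have X0: "X \<ge> 0" by (simp add: X_def sum_nonneg)
    have QX: "\<epsilon> * X \<le> Q"
      unfolding Q_def X_def using sum0
      by (intro energy_ge_algebraic_connectivity[OF G cardV \<epsilon>]) (simp add: x_def)
    have edge_sums: "(\<Sum>e\<in>edges G. (\<Sum>v\<in>e. x v)\<^sup>2) = 2 * real k * X - Q"
      using regular_energy(1)[OF G reg, of x] by (simp add: X_def Q_def)
    have corona_part: "(\<Sum>e\<in>edges G. \<Sum>u\<in>verts H.
        (\<Sum>v\<in>e. (x v)\<^sup>2) - (\<Sum>v\<in>e. x v)\<^sup>2 / (2 - t) + t * (f (Inr (e, u)))\<^sup>2)
      = real n * (\<Sum>e\<in>edges G. \<Sum>v\<in>e. (x v)\<^sup>2)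
        - real n * (\<Sum>e\<in>edges G. (\<Sum>v\<in>e. x v)\<^sup>2) / (2 - t) + t * Y"
      by (simp add: sum.distrib sum_subtractf H(2) Y_def right_diff_distrib flip: sum_distrib_left sum_divide_distrib)
    have "real n * (real k * X) - real n * (2 * real k * X - Q) / (2 - t) + t * Y
      = (\<Sum>e\<in>edges G. \<Sum>u\<in>verts H.
        (\<Sum>v\<in>e. (x v)\<^sup>2) - (\<Sum>v\<in>e. x v)\<^sup>2 / (2 - t) + t * (f (Inr (e, u)))\<^sup>2)"
      unfolding corona_part by (simp add: edge_sums regular_energy(2)[OF G reg] X_def)
    also have "\<dots> \<le> (\<Sum>e\<in>edges G. \<Sum>u\<in>verts H. \<Sum>v\<in>e. (x v - f (Inr (e, u)))\<^sup>2)"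
      using G t(2) by (intro sum_mono edge_vertex_bound) (auto simp: simple_graph_def)
    finally have lower: "real n * (real k * X) - real n * (2 * real k * X - Q) / (2 - t) + t * Y
        \<le> (\<Sum>e\<in>edges G. \<Sum>u\<in>verts H. \<Sum>v\<in>e. (x v - f (Inr (e, u)))\<^sup>2)" .
    \<comment> \<open>Multiplying by \<open>2 - t > 0\<close> clears the denominator. After
      regrouping, \<open>QX\<close> makes the first summand nonnegative, and the second vanishes
      because \<open>t\<close> is a root of the quadratic.\<close>
    have "(2 - t) * (Q + real n * (real k * X) - real n * (2 * real k * X - Q) / (2 - t) - t * X)
        = (2 - t) * (Q + real n * (real k * X) - t * X) - real n * (2 * real k * X - Q)"
      using t(2) by (simp add: field_simps)
    also have "\<dots> = (2 - t + real n) * (Q - \<epsilon> * X)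
        + X * (t\<^sup>2 - (\<epsilon> + real n * real k + 2) * t + (real n + 2) * \<epsilon>)"
      by (simp add: power2_eq_square algebra_simps)
    also have "\<dots> \<ge> 0" using t QX by simp
    finally have "0 \<le> Q + real n * (real k * X) - real n * (2 * real k * X - Q) / (2 - t) - t * X"
      using t(2) by (simp add: zero_le_mult_iff)
    then have "t * (X + Y) \<le> Q + (\<Sum>e\<in>edges G. \<Sum>u\<in>verts H. \<Sum>v\<in>e. (x v - f (Inr (e, u)))\<^sup>2)"
      using lower by (simp add: distrib_left)
    also have "\<dots> \<le> energy G' f"
      using corona_supergraph_energy_ge[OF G H(1) G' sub, of f] by (simp add: Q_def x_def)
    also have "X + Y = (\<Sum>w\<in>verts G'. (f w)\<^sup>2)"
      by (simp add: corona_sum X_def Y_def x_def)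
    finally show "t * (\<Sum>w\<in>verts G'. (f w)\<^sup>2) \<le> energy G' f" .
  qed
qed

section \<open>Assembly of the expander family\<close>

theorem theorem3p7:
  fixes G :: "nat \<Rightarrow> 'a ugraph"
    and H :: "'b ugraph"
    and GH :: "nat \<Rightarrow> ('a + 'a set \<times> 'b) ugraph"
    and k r n :: nat
    and \<epsilon> :: real
  assumes "k \<ge> 3" and "\<epsilon> > 0"
    and "expander_family \<epsilon> G"
    and "\<And>i. regular_graph k (G i)"
    and "\<And>i. \<not> complete_graph (G i)"
    and "simple_graph H" and "connected_graph H" and "regular_graph r H"
    and "card (verts H) = n" and "\<not> complete_graph H"
    and "\<And>i. regular_graph ((n + 1) * k) (GH i)"
    and "\<And>i. obtained_by_adding_edges
           (real n * (real ((n + 1) * k) - real r - 2) * real (card (edges (G i))) / 2)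
           (edge_corona (G i) H) (GH i)"
  shows "expander_family (g_fun n k \<epsilon> / 2) GH \<and> (\<forall>i. regular_graph ((n + 1) * k) (GH i))"
proof -
  have H: "finite (verts H)" using assms(6) by (simp add: simple_graph_def)
  \<comment> \<open>Connectedness includes nonemptiness. Positive \<open>n\<close> makes the
    quadratic strictly negative at 2.\<close>
  have n: "n > 0" using assms(7,9) H by (auto simp: connected_graph_def card_gt_0_iff)
  have G: "simple_graph (G i)" and aG: "\<epsilon> \<le> algebraic_connectivity (G i)" for i
    using assms(3) by (auto simp: expander_family_def)
  have GH: "simple_graph (GH i)" "verts (GH i) = verts (edge_corona (G i) H)"
    "edges (edge_corona (G i) H) \<subseteq> edges (GH i)" for i
    using assms(12)[of i] by (auto simp: obtained_by_adding_edges_def)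
  have "\<epsilon> \<le> real k"
    by (rule algebraic_connectivity_le_degree[OF G assms(4,5,2) aG])
  then have "\<epsilon> < 2 * real k" using assms(2) by linarith
  then have pos: "0 < g_fun n k \<epsilon> / 2" by (rule g_fun_half(1)[OF assms(2) _ n])
  have ac: "g_fun n k \<epsilon> / 2 \<le> algebraic_connectivity (GH i)" for i
    by (rule corona_supergraph_algebraic_connectivity[OF G assms(4,5) H assms(9) n assms(2) aG GH])
  \<comment> \<open>\<open>Inl\<close> embeds the base graph, so the vertex counts tend to infinity
    by comparison.\<close>
  have "card (verts (G i)) \<le> card (verts (GH i))" for i
  proof -
    have "finite (verts (GH i))" using GH(1) by (simp add: simple_graph_def)
    then have "card (Inl ` verts (G i) :: ('a + 'a set \<times> 'b) set) \<le> card (verts (GH i))"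
      by (intro card_mono) (auto simp: GH(2) edge_corona_def)
    then show ?thesis by (simp add: card_image)
  qed
  then have "filterlim (\<lambda>i. card (verts (GH i))) at_top sequentially"
    using assms(3) unfolding expander_family_def
    by (auto intro: filterlim_at_top_mono)
  moreover have "(n + 1) * k \<ge> 3" using assms(1) by simp
  ultimately show ?thesis
    unfolding expander_family_def using pos GH(1) ac assms(11) by blast
qed

end
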